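(* Let $X$ be an infinite Hausdorff space which is totally disconnected and of countable tightness. Then $\mathscr{F}(X)$ has a continuous selection if and only if $\mathscr{F}(X\setminus\{p\})$ has a continuous selection for every $p\in X$.
   Context: A space $X$ is totally disconnected here if each singleton of $X$ is an intersection of clopen subsets of $X$. A space $X$ is of countable tightness if for each $A\subset X$ and $x\in\overline{A}$ there is a countable set $B\subset A$ with $x\in\overline{B}$. For a topological space $Z$, $\mathscr{F}(Z)$ is the set of all nonempty closed subsets of $Z$, endowed with the Vietoris topology, i.e. the topology generated by all collections $\langle\mathscr{V}\rangle=\{S\in\mathscr{F}(Z): S\subset\bigcup\mathscr{V}\text{ and }S\cap V\neq\varnothing\text{ for every }V\in\mathscr{V}\}$, where $\mathscr{V}$ runs over the finite families of open subsets of $Z$. The set $X\setminus\{p\}$ carries the subspace topology. A selection for $\mathscr{F}(Z)$ is a map $f:\mathscr{F}(Z)\to Z$ with $f(S)\in S$ for all $S\in\mathscr{F}(Z)$; it is continuous if it is continuous with respect to the Vietoris topology on $\mathscr{F}(Z)$. *)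

theory Defs
  imports "HOL-Analysis.Analysis"
begin

definition clopenin :: "'a topology \<Rightarrow> 'a set \<Rightarrow> bool" where
  "clopenin X U \<longleftrightarrow> openin X U \<and> closedin X U"

text \<open>
  Total disconnectedness in the sense of quasi-components (stronger than requiring only that
  connected components be singletons). The meet with the carrier is only the convention that
  the intersection of the empty family is the whole space.
\<close>

definition totally_disconnected_space :: "'a topology \<Rightarrow> bool" where
  "totally_disconnected_space X \<longleftrightarrow>
     (\<forall>x \<in> topspace X. \<exists>\<C>. (\<forall>U \<in> \<C>. clopenin X U) \<and> {x} = topspace X \<inter> \<Inter>\<C>)"

definition countable_tightness :: "'a topology \<Rightarrow> bool" where
  "countable_tightness X \<longleftrightarrow>
     (\<forall>A x. A \<subseteq> topspace X \<longrightarrow> x \<in> X closure_of A \<longrightarrow>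
        (\<exists>B. countable B \<and> B \<subseteq> A \<and> x \<in> X closure_of B))"

definition closed_hyperspace :: "'a topology \<Rightarrow> 'a set set" where
  "closed_hyperspace Z = {S. closedin Z S \<and> S \<noteq> {}}"

definition vietoris_basic :: "'a topology \<Rightarrow> 'a set set \<Rightarrow> 'a set set" where
  "vietoris_basic Z \<V> = {S \<in> closed_hyperspace Z. S \<subseteq> \<Union>\<V> \<and> (\<forall>V \<in> \<V>. S \<inter> V \<noteq> {})}"

definition vietoris_topology :: "'a topology \<Rightarrow> 'a set topology" where
  "vietoris_topology Z =
     topology_generated_by {vietoris_basic Z \<V> | \<V>. finite \<V> \<and> (\<forall>V \<in> \<V>. openin Z V)}"

lemma topspace_vietoris_topology [simp]:
  "topspace (vietoris_topology Z) = closed_hyperspace Z"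
proof
  show "topspace (vietoris_topology Z) \<subseteq> closed_hyperspace Z"
    by (auto simp: vietoris_topology_def vietoris_basic_def)
  have "S \<in> vietoris_basic Z {topspace Z}" if "S \<in> closed_hyperspace Z" for S
    using that closedin_subset[of Z S]
    by (auto simp: vietoris_basic_def closed_hyperspace_def)
  moreover have "finite {topspace Z} \<and> (\<forall>V \<in> {topspace Z}. openin Z V)"
    by simp
  ultimately show "closed_hyperspace Z \<subseteq> topspace (vietoris_topology Z)"
    unfolding vietoris_topology_def topology_generated_by_topspace by blast
qed

text \<open>Values of a selection outside the hyperspace are irrelevant.\<close>

definition hyperspace_selection :: "'a topology \<Rightarrow> ('a set \<Rightarrow> 'a) \<Rightarrow> bool" where
  "hyperspace_selection Z f \<longleftrightarrow> (\<forall>S \<in> closed_hyperspace Z. f S \<in> S)"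

definition has_continuous_selection :: "'a topology \<Rightarrow> bool" where
  "has_continuous_selection Z \<longleftrightarrow>
     (\<exists>f. hyperspace_selection Z f \<and> continuous_map (vietoris_topology Z) Z f)"

end

theory Submission
  imports Defs
begin

text \<open>
  Selections can be glued along a countable clopen cover: select from the first member of the
  cover that the closed set meets. If \<open>X\<close> splits into two nonempty clopen parts, each part is
  closed in some \<open>X - {p}\<close>, which gives one implication.

  For the other one it suffices that \<open>p\<close> is a countable intersection of clopen sets, since their
  complements then cover \<open>X - {p}\<close>. Given a selection \<open>f\<close>, split \<open>X - {p}\<close> into
  \<open>L = {x. f {x, p} = x}\<close> and \<open>R = {x. f {x, p} = p}\<close>. If \<open>p\<close> is in the closure of \<open>L\<close>, take a
  countable \<open>B \<subseteq> L\<close> whose closure contains \<open>p\<close>. For \<open>b \<in> B\<close> some clopen neighbourhood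
  of \<open>p\<close> contains only points \<open>y \<noteq> b\<close> with \<open>f {b, y} = b\<close>. No \<open>y \<in> L\<close> lies in all of
  these sets: \<open>f {y, z} = y\<close> holds for all \<open>z\<close> near \<open>p\<close>, in particular for some \<open>z \<in> B\<close>.
  The set \<open>R\<close> is treated in the same way.
\<close>

section \<open>Open sets of the Vietoris topology and continuity into it\<close>

lemma openin_vietoris_basic:
  assumes "finite \<V>" "\<And>V. V \<in> \<V> \<Longrightarrow> openin Z V"
  shows "openin (vietoris_topology Z) (vietoris_basic Z \<V>)"
  unfolding vietoris_topology_def
  by (rule topology_generated_by_Basis) (use assms in blast)

lemma openin_vietoris_subset:
  assumes "openin Z U"
  shows "openin (vietoris_topology Z) {S \<in> closed_hyperspace Z. S \<subseteq> U}"
proof -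
  have "{S \<in> closed_hyperspace Z. S \<subseteq> U} = vietoris_basic Z {U}"
    by (auto simp: vietoris_basic_def closed_hyperspace_def)
  then show ?thesis
    using openin_vietoris_basic[of "{U}" Z] assms by simp
qed

lemma openin_vietoris_meets:
  assumes "openin Z U"
  shows "openin (vietoris_topology Z) {S \<in> closed_hyperspace Z. S \<inter> U \<noteq> {}}"
proof -
  \<comment> \<open>Adding \<open>topspace Z\<close> to the family makes the covering condition
    vacuous; it is met automatically because \<open>S\<close> is nonempty.\<close>
  have "{S \<in> closed_hyperspace Z. S \<inter> U \<noteq> {}} = vietoris_basic Z {U, topspace Z}"
    by (auto simp: vietoris_basic_def closed_hyperspace_def dest: closedin_subset)
  then show ?thesis
    using openin_vietoris_basic[of "{U, topspace Z}" Z] assms by force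
qed

text \<open>A basic set is a finite intersection of sets of the two kinds, "contained in an open
  set" and "meeting an open set", so these two kinds suffice as a subbase.\<close>

lemma continuous_map_into_vietoris:
  assumes hyp: "\<And>y. y \<in> topspace Y \<Longrightarrow> g y \<in> closed_hyperspace Z"
    and sub: "\<And>U. openin Z U \<Longrightarrow> openin Y {y \<in> topspace Y. g y \<subseteq> U}"
    and meets: "\<And>U. openin Z U \<Longrightarrow> openin Y {y \<in> topspace Y. g y \<inter> U \<noteq> {}}"
  shows "continuous_map Y (vietoris_topology Z) g"
  unfolding vietoris_topology_def
proof (rule continuous_on_generated_topo)
  fix \<U>
  assume "\<U> \<in> {vietoris_basic Z \<V> | \<V>. finite \<V> \<and> (\<forall>V \<in> \<V>. openin Z V)}"
  then obtain \<V> where \<V>: "\<U> = vietoris_basic Z \<V>" "finite \<V>" "\<forall>V \<in> \<V>. openin Z V"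
    by blast
  have "g -` \<U> \<inter> topspace Y = \<Inter>((\<lambda>V. {y \<in> topspace Y. g y \<inter> V \<noteq> {}}) ` \<V>)
      \<inter> {y \<in> topspace Y. g y \<subseteq> \<Union>\<V>}"
  proof (rule set_eqI)
    fix y
    show "y \<in> g -` \<U> \<inter> topspace Y \<longleftrightarrow>
        y \<in> \<Inter>((\<lambda>V. {y \<in> topspace Y. g y \<inter> V \<noteq> {}}) ` \<V>) \<inter> {y \<in> topspace Y. g y \<subseteq> \<Union>\<V>}"
      using hyp[of y] by (simp add: \<V>(1) vietoris_basic_def) blast
  qed
  \<comment> \<open>Inserting the containment set keeps the family nonempty even for empty
    \<open>\<V>\<close>, where the bare intersection would be the whole type.\<close>
  also have "\<dots> = \<Inter>(insert {y \<in> topspace Y. g y \<subseteq> \<Union>\<V>}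
      ((\<lambda>V. {y \<in> topspace Y. g y \<inter> V \<noteq> {}}) ` \<V>))"
    by (simp only: Inter_insert Int_commute)
  also have "openin Y \<dots>"
    using \<V> by (intro openin_Inter) (auto intro: sub meets)
  finally show "openin Y (g -` \<U> \<inter> topspace Y)" .
next
  have "g ` topspace Y \<subseteq> topspace (vietoris_topology Z)"
    using hyp by auto
  then show "g ` topspace Y
      \<subseteq> \<Union>{vietoris_basic Z \<V> | \<V>. finite \<V> \<and> (\<forall>V \<in> \<V>. openin Z V)}"
    by (simp only: vietoris_topology_def topology_generated_by_topspace)
qed

section \<open>Restricting and gluing selections\<close>

text \<open>Closed subsets of \<open>D\<close> are closed in \<open>Z\<close>, and this inclusion of
  hyperspaces is continuous. So \<open>f\<close> restricts, and its values stay in \<open>D\<close>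
  because \<open>f S\<close> lies in \<open>S\<close>.\<close>

lemma has_continuous_selection_closedin:
  assumes "has_continuous_selection Z" "closedin Z D"
  shows "has_continuous_selection (subtopology Z D)"
proof -
  obtain f where f: "hyperspace_selection Z f" "continuous_map (vietoris_topology Z) Z f"
    using assms(1) by (auto simp: has_continuous_selection_def)
  let ?D = "subtopology Z D"
  have hyp: "S \<in> closed_hyperspace Z" "S \<subseteq> D" if "S \<in> closed_hyperspace ?D" for S
    using that closedin_closed_subtopology[OF assms(2)] by (auto simp: closed_hyperspace_def)
  have "continuous_map (vietoris_topology ?D) (vietoris_topology Z) (\<lambda>S. S)"
  proof (rule continuous_map_into_vietoris)
    fix U assume U: "openin Z U"
    then have UD: "openin ?D (U \<inter> D)"
      by (auto simp: openin_subtopology)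
    have "{S \<in> topspace (vietoris_topology ?D). S \<subseteq> U}
        = {S \<in> closed_hyperspace ?D. S \<subseteq> U \<inter> D}"
      using hyp by auto
    then show "openin (vietoris_topology ?D) {S \<in> topspace (vietoris_topology ?D). S \<subseteq> U}"
      using openin_vietoris_subset[OF UD] by simp
    have "{S \<in> topspace (vietoris_topology ?D). S \<inter> U \<noteq> {}}
        = {S \<in> closed_hyperspace ?D. S \<inter> (U \<inter> D) \<noteq> {}}"
      using hyp by auto
    then show "openin (vietoris_topology ?D)
        {S \<in> topspace (vietoris_topology ?D). S \<inter> U \<noteq> {}}"
      using openin_vietoris_meets[OF UD] by simp
  qed (use hyp in auto)
  from continuous_map_compose[OF this f(2)]
  have "continuous_map (vietoris_topology ?D) Z f"
    by (simp add: o_def)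
  moreover have "f S \<in> S" if "S \<in> closed_hyperspace ?D" for S
    using f(1) hyp that by (auto simp: hyperspace_selection_def)
  ultimately have "hyperspace_selection ?D f" "continuous_map (vietoris_topology ?D) ?D f"
    using hyp by (fastforce simp: hyperspace_selection_def continuous_map_in_subtopology)+
  then show ?thesis
    by (auto simp: has_continuous_selection_def)
qed

text \<open>Both halves of clopenness enter: \<open>S \<inter> D \<subseteq> U\<close> says that
  \<open>S\<close> lies in \<open>U\<close> together with the complement of \<open>D\<close>, which
  is open as \<open>D\<close> is closed; and a set open in \<open>D\<close> is open in
  \<open>Z\<close> as \<open>D\<close> is open.\<close>

lemma continuous_map_vietoris_Int_clopenin:
  assumes "clopenin Z D"
  shows "continuous_map
      (subtopology (vietoris_topology Z) {S \<in> closed_hyperspace Z. S \<inter> D \<noteq> {}})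
      (vietoris_topology (subtopology Z D)) (\<lambda>S. S \<inter> D)"
proof -
  have D: "openin Z D" "closedin Z D"
    using assms by (auto simp: clopenin_def)
  let ?W = "{S \<in> closed_hyperspace Z. S \<inter> D \<noteq> {}}"
  have top: "topspace (subtopology (vietoris_topology Z) ?W) = ?W"
    by auto
  show ?thesis
  proof (rule continuous_map_into_vietoris; unfold top)
    show "S \<inter> D \<in> closed_hyperspace (subtopology Z D)" if "S \<in> ?W" for S
      using that D closedin_closed_subtopology[OF D(2)] by (auto simp: closed_hyperspace_def)
  next
    fix U assume "openin (subtopology Z D) U"
    then have U: "openin Z U" "U \<subseteq> D"
      using openin_open_subtopology[OF D(1)] by auto
    let ?V = "U \<union> (topspace Z - D)"
    have "{S \<in> ?W. S \<inter> D \<subseteq> U} = {S \<in> closed_hyperspace Z. S \<subseteq> ?V} \<inter> ?W"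
      by (auto simp: closed_hyperspace_def dest: closedin_subset)
    moreover have "openin Z ?V"
      using U D by (intro openin_Un openin_diff) auto
    ultimately show "openin (subtopology (vietoris_topology Z) ?W) {S \<in> ?W. S \<inter> D \<subseteq> U}"
      by (simp only: openin_subtopology_Int openin_vietoris_subset)
    have "{S \<in> ?W. S \<inter> D \<inter> U \<noteq> {}} = {S \<in> closed_hyperspace Z. S \<inter> U \<noteq> {}} \<inter> ?W"
      using U by auto
    then show "openin (subtopology (vietoris_topology Z) ?W) {S \<in> ?W. S \<inter> D \<inter> U \<noteq> {}}"
      using U(1) by (simp only: openin_subtopology_Int openin_vietoris_meets)
  qed
qed

text \<open>The closed sets whose first met member is \<open>D n\<close> form an open set of the
  hyperspace: meeting \<open>D n\<close> is an open condition since \<open>D n\<close> is open, and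
  missing each earlier \<open>D m\<close> is one since \<open>D m\<close> is closed. On each such
  piece the glued selection is continuous.\<close>

lemma has_continuous_selection_clopenin_cover:
  fixes D :: "nat \<Rightarrow> 'a set"
  assumes D: "\<And>n. clopenin Z (D n)"
    and sel: "\<And>n. has_continuous_selection (subtopology Z (D n))"
    and cover: "topspace Z \<subseteq> (\<Union>n. D n)"
  shows "has_continuous_selection Z"
proof -
  have "\<forall>n. \<exists>f. hyperspace_selection (subtopology Z (D n)) f \<and>
      continuous_map (vietoris_topology (subtopology Z (D n))) (subtopology Z (D n)) f"
    using sel by (simp add: has_continuous_selection_def)
  then obtain g where g: "\<And>n. hyperspace_selection (subtopology Z (D n)) (g n)"
      "\<And>n. continuous_map (vietoris_topology (subtopology Z (D n))) (subtopology Z (D n)) (g n)"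
    by metis
  define W where "W n = {S \<in> closed_hyperspace Z. S \<inter> D n \<noteq> {}}" for n
  define k where "k S = (LEAST n. S \<inter> D n \<noteq> {})" for S
  define h where "h S = g (k S) (S \<inter> D (k S))" for S
  have openW: "openin (vietoris_topology Z) (W n)" for n
    using openin_vietoris_meets[of Z "D n"] D[of n] by (simp add: W_def clopenin_def)
  have openW': "openin (vietoris_topology Z) {S \<in> closed_hyperspace Z. S \<subseteq> topspace Z - D n}" for n
    using D[of n] by (intro openin_vietoris_subset openin_diff) (auto simp: clopenin_def)
  have cont: "continuous_map (subtopology (vietoris_topology Z) (W n)) Z (\<lambda>S. g n (S \<inter> D n))" for n
    using continuous_map_compose[OF continuous_map_vietoris_Int_clopenin[OF D[of n]] g(2)]
    by (simp add: W_def o_def continuous_map_in_subtopology)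
  have k: "S \<in> W (k S)" if "S \<in> closed_hyperspace Z" for S
  proof -
    obtain x where "x \<in> S" "x \<in> topspace Z"
      using \<open>S \<in> closed_hyperspace Z\<close> by (auto simp: closed_hyperspace_def dest: closedin_subset)
    then obtain n where "S \<inter> D n \<noteq> {}"
      using cover by blast
    then have "S \<inter> D (k S) \<noteq> {}"
      unfolding k_def by (rule LeastI)
    then show ?thesis
      using that by (simp add: W_def)
  qed
  have k_eq: "k S = n" if "S \<in> W n" "\<And>m. m < n \<Longrightarrow> S \<inter> D m = {}" for S n
    using that unfolding k_def W_def by (intro Least_equality) (auto intro: leI)
  have k_less: "S \<inter> D m = {}" if "m < k S" for S m
    using that not_less_Least unfolding k_def by blast
  have "hyperspace_selection Z h"
    unfolding hyperspace_selection_def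
  proof
    fix S assume S: "S \<in> closed_hyperspace Z"
    have "S \<inter> D (k S) \<in> closed_hyperspace (subtopology Z (D (k S)))"
      using k[OF S] D[of "k S"]
      by (auto simp: closed_hyperspace_def W_def clopenin_def closedin_closed_subtopology)
    then have "g (k S) (S \<inter> D (k S)) \<in> S \<inter> D (k S)"
      using g(1)[of "k S"] unfolding hyperspace_selection_def by (rule bspec[rotated])
    then show "h S \<in> S"
      by (simp add: h_def)
  qed
  moreover have "continuous_map (vietoris_topology Z) Z h"
    unfolding continuous_map
  proof (intro conjI allI impI)
    show "h ` topspace (vietoris_topology Z) \<subseteq> topspace Z"
    proof (rule image_subsetI)
      fix S assume "S \<in> topspace (vietoris_topology Z)"
      then have S: "S \<in> closed_hyperspace Z"
        by simp
      then have "h S \<in> S"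
        using \<open>hyperspace_selection Z h\<close> by (simp add: hyperspace_selection_def)
      moreover have "S \<subseteq> topspace Z"
        using S by (simp add: closed_hyperspace_def closedin_subset)
      ultimately show "h S \<in> topspace Z"
        by blast
    qed
  next
    fix U assume U: "openin Z U"
    \<comment> \<open>\<open>Q n\<close> below is the set of those \<open>S\<close> with
      \<open>k S = n\<close> and \<open>h S \<in> U\<close>, so the preimage of \<open>U\<close>
      under \<open>h\<close> is the union of the \<open>Q n\<close>.\<close>
    define P where "P n = {S \<in> W n. g n (S \<inter> D n) \<in> U}" for n
    define Q where "Q n = P n \<inter> \<Inter>((\<lambda>m. {S \<in> closed_hyperspace Z. S \<subseteq> topspace Z - D m}) ` {..<n})"
      for n
    have "openin (subtopology (vietoris_topology Z) (W n))
        {S \<in> topspace (subtopology (vietoris_topology Z) (W n)). g n (S \<inter> D n) \<in> U}" for n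
      using openin_continuous_map_preimage[OF cont U] .
    moreover have "topspace (subtopology (vietoris_topology Z) (W n)) = W n" for n
      by (auto simp: W_def)
    ultimately have P: "openin (vietoris_topology Z) (P n)" for n
      using openin_open_subtopology[OF openW] by (simp only: P_def)
    have Q_eq: "Q n = \<Inter>(insert (P n)
        ((\<lambda>m. {S \<in> closed_hyperspace Z. S \<subseteq> topspace Z - D m}) ` {..<n}))" for n
      by (auto simp: Q_def)
    have Q: "openin (vietoris_topology Z) (Q n)" for n
      unfolding Q_eq by (rule openin_Inter) (use P openW' in auto)
    have "{S \<in> topspace (vietoris_topology Z). h S \<in> U} = (\<Union>n. Q n)"
    proof (intro equalityI subsetI)
      fix S assume "S \<in> {S \<in> topspace (vietoris_topology Z). h S \<in> U}"
      then have S: "S \<in> closed_hyperspace Z" "h S \<in> U"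
        by auto
      then have "S \<subseteq> topspace Z"
        by (auto simp: closed_hyperspace_def dest: closedin_subset)
      then have "S \<in> Q (k S)"
        using S k k_less by (fastforce simp: Q_def P_def h_def)
      then show "S \<in> (\<Union>n. Q n)"
        by blast
    next
      fix S assume "S \<in> (\<Union>n. Q n)"
      then obtain n where n: "S \<in> Q n"
        by blast
      have "k S = n"
        using n by (intro k_eq) (auto simp: Q_def P_def)
      then show "S \<in> {S \<in> topspace (vietoris_topology Z). h S \<in> U}"
        using n by (auto simp: Q_def P_def W_def h_def)
    qed
    then show "openin (vietoris_topology Z) {S \<in> topspace (vietoris_topology Z). h S \<in> U}"
      using Q by auto
  qed
  ultimately show ?thesis
    by (auto simp: has_continuous_selection_def)
qed

text \<open>The hyperspace is empty, so everything is vacuous. This serves the empty members that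
  pad a finite cover to a sequence.\<close>

lemma has_continuous_selection_empty:
  "has_continuous_selection (subtopology Z {})"
  by (auto simp: has_continuous_selection_def hyperspace_selection_def closed_hyperspace_def
      continuous_map_def)

section \<open>Points as countable intersections of clopen sets\<close>

lemma totally_disconnected_space_separation:
  assumes "totally_disconnected_space X" "x \<in> topspace X" "y \<in> topspace X" "x \<noteq> y"
  obtains U where "clopenin X U" "x \<in> U" "y \<notin> U"
proof -
  obtain \<C> where \<C>: "\<forall>U \<in> \<C>. clopenin X U" "{x} = topspace X \<inter> \<Inter>\<C>"
    using assms(1,2) by (auto simp: totally_disconnected_space_def)
  then have "x \<in> \<Inter>\<C>" "y \<notin> \<Inter>\<C>"
    using assms(3,4) by (metis IntD2 singletonI, metis IntI singletonD)
  then obtain U where "U \<in> \<C>" "x \<in> U" "y \<notin> U"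
    by blast
  then show thesis
    using \<C>(1) that by blast
qed

lemma clopenin_subtopology:
  assumes "clopenin X U" "U \<subseteq> S"
  shows "clopenin (subtopology X S) U"
  using assms by (auto simp: clopenin_def openin_subtopology closedin_subtopology)

text \<open>With a selection \<open>f\<close>, this makes \<open>f {b, y}\<close> a continuous
  function of \<open>y\<close>. The T1 axiom makes the pairs closed.\<close>

lemma continuous_map_vietoris_pair:
  assumes "t1_space X" "b \<in> topspace X"
  shows "continuous_map X (vietoris_topology X) (\<lambda>x. {b, x})"
proof (rule continuous_map_into_vietoris)
  show "{b, x} \<in> closed_hyperspace X" if "x \<in> topspace X" for x
    using assms that by (auto simp: closed_hyperspace_def t1_space_closedin_finite)
next
  fix U assume U: "openin X U"
  then have "{x \<in> topspace X. {b, x} \<subseteq> U} = (if b \<in> U then U else {})"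
      and "{x \<in> topspace X. {b, x} \<inter> U \<noteq> {}} = (if b \<in> U then topspace X else U)"
    using openin_subset[OF U] by auto
  then show "openin X {x \<in> topspace X. {b, x} \<subseteq> U}" "openin X {x \<in> topspace X. {b, x} \<inter> U \<noteq> {}}"
    using U by auto
qed

lemma hyperspace_selection_pair:
  assumes "t1_space X" "hyperspace_selection X f" "x \<in> topspace X" "y \<in> topspace X"
  shows "f {x, y} \<in> {x, y}"
proof -
  have "{x, y} \<in> closed_hyperspace X"
    using assms by (simp add: closed_hyperspace_def t1_space_closedin_finite)
  then show ?thesis
    using assms(2) unfolding hyperspace_selection_def by (rule bspec[rotated])
qed

text \<open>On a clopen neighbourhood \<open>C\<close> of \<open>p\<close> that misses
  \<open>b\<close>, whether \<open>f\<close> prefers \<open>b\<close> to \<open>y\<close> is decided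
  by whether \<open>f {b, y}\<close> lies in \<open>C\<close>. Points with the same preference as
  \<open>p\<close> thus form the preimage of a clopen set.\<close>

lemma clopenin_neighbourhood_constant_choice:
  assumes "t1_space X" "totally_disconnected_space X"
    and f: "hyperspace_selection X f" "continuous_map (vietoris_topology X) X f"
    and p: "p \<in> topspace X" and b: "b \<in> topspace X" "b \<noteq> p"
  obtains N where "clopenin X N" "p \<in> N"
    "\<forall>y \<in> N. y \<noteq> b \<and> (f {b, y} = b \<longleftrightarrow> f {b, p} = b)"
proof -
  obtain C where C: "clopenin X C" "p \<in> C" "b \<notin> C"
    using totally_disconnected_space_separation[OF assms(2) p b(1)] b(2) by metis
  have cont: "continuous_map X X (\<lambda>y. f {b, y})"
    using continuous_map_compose[OF continuous_map_vietoris_pair[OF assms(1) b(1)] f(2)]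
    by (simp add: o_def)
  have sel: "f {b, y} \<in> {b, y}" if "y \<in> topspace X" for y
    using hyperspace_selection_pair[OF assms(1) f(1) b(1) that] .
  have CX: "C \<subseteq> topspace X"
    using C(1) by (auto simp: clopenin_def dest: openin_subset)
  have choice: "f {b, y} = b \<longleftrightarrow> f {b, y} \<notin> C" if "y \<in> C" for y
    using sel[OF subsetD[OF CX that]] that C(3) by auto
  \<comment> \<open>\<open>E\<close> is whichever of \<open>C\<close> and its complement contains
    \<open>f {b, p}\<close>.\<close>
  define E where "E = (if f {b, p} = b then topspace X - C else C)"
  have E: "clopenin X E"
    using C(1) by (auto simp: E_def clopenin_def)
  define N where "N = C \<inter> {y \<in> topspace X. f {b, y} \<in> E}"
  have mem: "y \<in> N \<longleftrightarrow> y \<in> C \<and> (f {b, y} = b \<longleftrightarrow> f {b, p} = b)" for y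
    using choice[of y] sel[of y] CX b(1) by (auto simp: N_def E_def)
  show thesis
  proof
    show "clopenin X N"
      using C(1) E openin_continuous_map_preimage[OF cont] closedin_continuous_map_preimage[OF cont]
      by (auto simp: N_def clopenin_def)
  qed (use mem C in auto)
qed

text \<open>
  The set \<open>A\<close> is one of the two halves \<open>L\<close>, \<open>R\<close> of \<open>X - {p}\<close>, according to the truth value \<open>c\<close>.
\<close>

lemma countable_clopenin_avoiding_half:
  assumes "t1_space X" "totally_disconnected_space X" "countable_tightness X"
    and f: "hyperspace_selection X f" "continuous_map (vietoris_topology X) X f"
    and p: "p \<in> topspace X"
    and A_def: "A = {x \<in> topspace X - {p}. f {x, p} = x \<longleftrightarrow> c}"
  obtains \<N> where "countable \<N>" "\<forall>N \<in> \<N>. clopenin X N \<and> p \<in> N" "A \<inter> \<Inter>\<N> = {}"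
proof -
  have "\<forall>b \<in> topspace X - {p}. \<exists>N. clopenin X N \<and> p \<in> N \<and>
      (\<forall>y \<in> N. y \<noteq> b \<and> (f {b, y} = b \<longleftrightarrow> f {b, p} = b))"
  proof
    fix b assume "b \<in> topspace X - {p}"
    then have "b \<in> topspace X" "b \<noteq> p"
      by auto
    from clopenin_neighbourhood_constant_choice[OF assms(1,2) f p this]
    obtain M where "clopenin X M" "p \<in> M"
      "\<forall>y \<in> M. y \<noteq> b \<and> (f {b, y} = b \<longleftrightarrow> f {b, p} = b)" .
    then show "\<exists>N. clopenin X N \<and> p \<in> N \<and>
        (\<forall>y \<in> N. y \<noteq> b \<and> (f {b, y} = b \<longleftrightarrow> f {b, p} = b))"
      by blast
  qed
  \<comment> \<open>\<open>N\<close> is chosen at all points other than \<open>p\<close>, since it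
    is applied to members of \<open>B\<close> and also to the hypothetical common point
    \<open>y\<close>.\<close>
  then obtain N where N: "\<And>b. b \<in> topspace X - {p} \<Longrightarrow> clopenin X (N b) \<and> p \<in> N b"
    "\<And>b y. b \<in> topspace X - {p} \<Longrightarrow> y \<in> N b \<Longrightarrow>
      y \<noteq> b \<and> (f {b, y} = b \<longleftrightarrow> f {b, p} = b)"
    by metis
  have AX: "A \<subseteq> topspace X" "p \<notin> A"
    by (auto simp: A_def)
  have sel: "f {x, y} \<in> {x, y}" if "x \<in> topspace X" "y \<in> topspace X" for x y
    using hyperspace_selection_pair[OF assms(1) f(1) that] .
  show thesis
  proof (cases "p \<in> X closure_of A")
    case True
    then obtain B where B: "countable B" "B \<subseteq> A" "p \<in> X closure_of B"
      using assms(3) AX(1) unfolding countable_tightness_def by meson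
    have "A \<inter> \<Inter>(N ` B) = {}"
    proof (rule ccontr)
      assume "A \<inter> \<Inter>(N ` B) \<noteq> {}"
      then obtain y where y: "y \<in> A" "\<And>b. b \<in> B \<Longrightarrow> y \<in> N b"
        by blast
      then have yX: "y \<in> topspace X - {p}"
        using AX by auto
      then obtain b where b: "b \<in> B" "b \<in> N y"
        using B(3) N(1)[of y] by (auto simp: in_closure_of clopenin_def)
      then have bX: "b \<in> topspace X - {p}" "b \<in> A"
        using AX B by auto
      \<comment> \<open>From \<open>b \<in> N y\<close> and \<open>y \<in> N b\<close>, with both
        points in \<open>A\<close>, either both or neither of them would be the value on their
        pair.\<close>
      have "f {y, b} = y \<longleftrightarrow> c" "b \<noteq> y"
        using N(2)[OF yX b(2)] y(1) by (auto simp: A_def)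
      moreover have "f {b, y} = b \<longleftrightarrow> c"
        using N(2)[OF bX(1) y(2)[OF b(1)]] bX(2) by (auto simp: A_def)
      moreover have "f {b, y} \<in> {b, y}"
        using sel bX yX by auto
      ultimately show False
        by (auto simp: insert_commute)
    qed
    moreover have "countable (N ` B)"
      using B(1) by simp
    moreover have "\<forall>M \<in> N ` B. clopenin X M \<and> p \<in> M"
      using N(1) B(2) AX by auto
    ultimately show thesis
      by (rule that[rotated 2])
  next
    case False
    \<comment> \<open>The neighbourhood lemma is now applied around \<open>x\<close> with
      \<open>p\<close> as the fixed point. It controls whether \<open>p\<close> is chosen, while
      \<open>A\<close> records whether the other point is; this converts between the two.\<close>
    have swap: "f {y, p} = y \<longleftrightarrow> f {p, y} \<noteq> p" if "y \<in> topspace X" "y \<noteq> p" for y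
    proof -
      have "{p, y} = {y, p}"
        by blast
      then show ?thesis
        using sel[OF that(1) p] that(2) by auto
    qed
    have "openin X A"
    proof (subst openin_subopen, intro ballI)
      fix x assume x: "x \<in> A"
      then have xX: "x \<in> topspace X" "x \<noteq> p"
        using AX by auto
      obtain M where M: "clopenin X M" "x \<in> M"
        "\<forall>y \<in> M. y \<noteq> p \<and> (f {p, y} = p \<longleftrightarrow> f {p, x} = p)"
        using clopenin_neighbourhood_constant_choice[OF assms(1,2) f xX(1) p xX(2)[symmetric]] .
      have MX: "M \<subseteq> topspace X"
        using M(1) by (auto simp: clopenin_def dest: openin_subset)
      have "f {x, p} = x \<longleftrightarrow> c"
        using x by (simp add: A_def)
      then have "M \<subseteq> A"
        using M(3) MX swap swap[OF xX] unfolding A_def by blast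
      then show "\<exists>T. openin X T \<and> x \<in> T \<and> T \<subseteq> A"
        using M by (auto simp: clopenin_def)
    qed
    moreover have "closedin X A"
    proof -
      \<comment> \<open>Membership in \<open>A\<close> is locally constant away from
        \<open>p\<close>, and \<open>p\<close> is outside the closure. So \<open>A\<close> is clopen
        and its complement alone serves as the family.\<close>
      have "X closure_of A \<subseteq> A"
      proof
        fix x assume x: "x \<in> X closure_of A"
        then have xX: "x \<in> topspace X" "x \<noteq> p"
          using False by (auto simp: in_closure_of)
        obtain M where M: "clopenin X M" "x \<in> M"
          "\<forall>y \<in> M. y \<noteq> p \<and> (f {p, y} = p \<longleftrightarrow> f {p, x} = p)"
          using clopenin_neighbourhood_constant_choice[OF assms(1,2) f xX(1) p xX(2)[symmetric]] .
        from M(1,2) obtain y where y: "y \<in> A" "y \<in> M"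
          using x by (auto simp: in_closure_of clopenin_def)
        then have "f {y, p} = y \<longleftrightarrow> c" "y \<in> topspace X" "y \<noteq> p"
          by (auto simp: A_def)
        then have "f {x, p} = x \<longleftrightarrow> c"
          using swap[of y] swap[OF xX] M(3) y(2) by blast
        then show "x \<in> A"
          using xX by (simp add: A_def)
      qed
      then show ?thesis
        using AX closure_of_subset_eq by blast
    qed
    ultimately have "clopenin X (topspace X - A)"
      by (auto simp: clopenin_def)
    then show thesis
      using that[of "{topspace X - A}"] p AX by auto
  qed
qed

text \<open>The halves for the truth values \<open>True\<close> and \<open>False\<close> exhaust the
  points other than \<open>p\<close>, so the union of the two families excludes all of them.\<close>

lemma countable_clopenin_Inter_singleton:
  assumes "t1_space X" "totally_disconnected_space X" "countable_tightness X"
    and "has_continuous_selection X" "p \<in> topspace X"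
  obtains \<N> where "countable \<N>" "\<forall>N \<in> \<N>. clopenin X N" "topspace X \<inter> \<Inter>\<N> = {p}"
proof -
  obtain f where f: "hyperspace_selection X f" "continuous_map (vietoris_topology X) X f"
    using assms(4) by (auto simp: has_continuous_selection_def)
  obtain \<L> where \<L>: "countable \<L>" "\<forall>N \<in> \<L>. clopenin X N \<and> p \<in> N"
      "{x \<in> topspace X - {p}. f {x, p} = x \<longleftrightarrow> True} \<inter> \<Inter>\<L> = {}"
    using countable_clopenin_avoiding_half[OF assms(1-3) f assms(5) refl, of True] .
  obtain \<R> where \<R>: "countable \<R>" "\<forall>N \<in> \<R>. clopenin X N \<and> p \<in> N"
      "{x \<in> topspace X - {p}. f {x, p} = x \<longleftrightarrow> False} \<inter> \<Inter>\<R> = {}"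
    using countable_clopenin_avoiding_half[OF assms(1-3) f assms(5) refl, of False] .
  show thesis
  proof
    show "countable (\<L> \<union> \<R>)" "\<forall>N \<in> \<L> \<union> \<R>. clopenin X N"
      using \<L> \<R> by auto
    show "topspace X \<inter> \<Inter>(\<L> \<union> \<R>) = {p}"
    proof (intro equalityI subsetI)
      fix x assume x: "x \<in> topspace X \<inter> \<Inter>(\<L> \<union> \<R>)"
      show "x \<in> {p}"
      proof (rule ccontr)
        assume "x \<notin> {p}"
        then have "x \<in> {x \<in> topspace X - {p}. f {x, p} = x \<longleftrightarrow> f {x, p} = x}"
          using x by simp
        moreover have "x \<in> \<Inter>\<L>" "x \<in> \<Inter>\<R>"
          using x by simp_all
        ultimately show False
          using \<L>(3) \<R>(3) by (cases "f {x, p} = x") blast+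
      qed
    qed (use \<L>(2) \<R>(2) assms(5) in blast)
  qed
qed

section \<open>The two implications\<close>

lemma has_continuous_selection_delete_point:
  assumes "t1_space X" "totally_disconnected_space X" "countable_tightness X"
    and "has_continuous_selection X" "p \<in> topspace X"
  shows "has_continuous_selection (subtopology X (topspace X - {p}))"
proof -
  obtain \<N> where \<N>: "countable \<N>" "\<forall>N \<in> \<N>. clopenin X N" "topspace X \<inter> \<Inter>\<N> = {p}"
    using countable_clopenin_Inter_singleton[OF assms] .
  \<comment> \<open>Inserting \<open>topspace X\<close> guarantees a nonempty family to enumerate;
    it only adds the empty set to the cover by complements.\<close>
  define N where "N = from_nat_into (insert (topspace X) \<N>)"
  have N: "range N = insert (topspace X) \<N>"
    using \<N>(1) by (simp add: N_def range_from_nat_into)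
  have clopen: "clopenin X (topspace X - N n)" for n
  proof -
    have "N n \<in> insert (topspace X) \<N>"
      using N by blast
    then show ?thesis
      using \<N>(2) by (auto simp: clopenin_def)
  qed
  have "p \<in> N n" for n
  proof -
    have "N n \<in> insert (topspace X) \<N>"
      using N by blast
    then show ?thesis
      using \<N>(3) assms(5) by auto
  qed
  then have sub: "topspace X - N n \<subseteq> topspace X - {p}" for n
    by auto
  let ?Z = "subtopology X (topspace X - {p})"
  show ?thesis
  proof (rule has_continuous_selection_clopenin_cover[where D = "\<lambda>n. topspace X - N n"])
    show "clopenin ?Z (topspace X - N n)" for n
      using clopenin_subtopology[OF clopen sub] .
    have "subtopology ?Z (topspace X - N n) = subtopology X (topspace X - N n)" for n
      using sub[of n] by (simp add: subtopology_subtopology Int_absorb1)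
    then show "has_continuous_selection (subtopology ?Z (topspace X - N n))" for n
      using has_continuous_selection_closedin[OF assms(4)] clopen[of n] by (simp add: clopenin_def)
    show "topspace ?Z \<subseteq> (\<Union>n. topspace X - N n)"
    proof
      fix x assume "x \<in> topspace ?Z"
      then have x: "x \<in> topspace X" "x \<noteq> p"
        by auto
      then obtain M where "M \<in> \<N>" "x \<notin> M"
        using \<N>(3) by blast
      then obtain n where "N n = M"
        using N by (metis insertI2 rangeE)
      then show "x \<in> (\<Union>n. topspace X - N n)"
        using x \<open>x \<notin> M\<close> by auto
    qed
  qed
qed

text \<open>A clopen set separating \<open>p\<close> from \<open>q\<close> misses \<open>q\<close>,
  and its complement misses \<open>p\<close>. Each is therefore closed in one of the two deleted
  spaces and inherits a selection, and the two are glued.\<close>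

lemma has_continuous_selection_from_deletions:
  assumes tdc: "totally_disconnected_space X"
    and pq: "p \<in> topspace X" "q \<in> topspace X" "p \<noteq> q"
    and p: "has_continuous_selection (subtopology X (topspace X - {p}))"
    and q: "has_continuous_selection (subtopology X (topspace X - {q}))"
  shows "has_continuous_selection X"
proof -
  have part: "has_continuous_selection (subtopology X C)"
    if "clopenin X C" "x \<notin> C" "has_continuous_selection (subtopology X (topspace X - {x}))" for x C
  proof -
    have C: "C \<subseteq> topspace X - {x}"
      using that by (auto simp: clopenin_def dest: openin_subset)
    then have "closedin (subtopology X (topspace X - {x})) C"
      using clopenin_subtopology[OF that(1)] by (simp add: clopenin_def)
    from has_continuous_selection_closedin[OF that(3) this] show ?thesis
      using C by (simp add: subtopology_subtopology Int_absorb1)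
  qed
  obtain U where U: "clopenin X U" "p \<in> U" "q \<notin> U"
    using totally_disconnected_space_separation[OF tdc pq] .
  then have V: "clopenin X (topspace X - U)"
    by (auto simp: clopenin_def)
  \<comment> \<open>The two-piece partition is padded with empty sets to fit the gluing along a
    sequence.\<close>
  define D where "D n = (if n = 0 then U else if n = 1 then topspace X - U else {})" for n :: nat
  show ?thesis
  proof (rule has_continuous_selection_clopenin_cover[where D = D])
    show "clopenin X (D n)" for n
      using U V by (auto simp: D_def clopenin_def)
    show "has_continuous_selection (subtopology X (D n))" for n
      using part[OF U(1,3) q] part[OF V _ p] U(2) has_continuous_selection_empty
      by (auto simp: D_def)
    have "D 0 \<union> D 1 \<subseteq> (\<Union>n. D n)"
      by blast
    then show "topspace X \<subseteq> (\<Union>n. D n)"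
      by (auto simp: D_def)
  qed
qed

theorem theorem4p3:
  fixes X :: "'a topology"
  assumes "infinite (topspace X)"
    and "Hausdorff_space X"
    and "totally_disconnected_space X"
    and "countable_tightness X"
  shows "has_continuous_selection X \<longleftrightarrow>
    (\<forall>p \<in> topspace X. has_continuous_selection (subtopology X (topspace X - {p})))"
proof
  assume "has_continuous_selection X"
  then show "\<forall>p \<in> topspace X. has_continuous_selection (subtopology X (topspace X - {p}))"
    using has_continuous_selection_delete_point[OF Hausdorff_imp_t1_space[OF assms(2)] assms(3,4)]
    by blast
next
  assume sel: "\<forall>p \<in> topspace X. has_continuous_selection (subtopology X (topspace X - {p}))"
  obtain p where p: "p \<in> topspace X"
    using infinite_imp_nonempty[OF assms(1)] by blast
  obtain q where q: "q \<in> topspace X" "q \<noteq> p"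
    using infinite_imp_nonempty[OF infinite_remove[OF assms(1), of p]] by blast
  show "has_continuous_selection X"
    using has_continuous_selection_from_deletions[OF assms(3) p q(1)] q sel p by blast
qed

end
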